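(* Let $d\ge2$ and let $A=S\Lambda S^{-1}\in\mathbb{C}^{d\times d}$ be diagonalizable by a known eigenvector basis $S$ (an invertible matrix), with $\Lambda=\mathrm{diag}(\lambda_0,\dots,\lambda_{d-1})$, and assume that the eigenvalues are absolutely collision-free. Let $\{\phi_i\}_{i=0}^{J-1}\subset\mathbb{C}^d$ allow parameter identification and phase retrieval, and let $y:=S^*x$ be elementwise non-zero for the unknown $x\in\mathbb{C}^d$. Then the eigenvalues $\lambda_0,\dots,\lambda_{d-1}$ of $A$ and the signal $x$ are determined by the spatiotemporal samples $$\bigl\{|\langle x,A^\ell\phi_i\rangle| : i=0,\dots,J-1,\ \ell=0,\dots,2L_i^2-1\bigr\}\quad\text{with}\quad L_i:=\#[\operatorname{supp}(S^{-1}\phi_i)]$$ up to global phase. That is, if $A'=S\,\mathrm{diag}(\lambda'_0,\dots,\lambda'_{d-1})S^{-1}$ and $x'$ satisfy the same hypotheses and yield the same samples, then there are $\theta,\vartheta\in\mathbb{R}$ with $\lambda'_k=e^{i\theta}\lambda_k$ for all $k$ and $x'=e^{i\vartheta}x$.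
   Context: $\langle\cdot,\cdot\rangle$ is the standard inner product on $\mathbb{C}^d$; $S^*$ is the conjugate transpose; $\operatorname{supp}$ is the set of indices of non-zero components. Complex numbers $\mu_0,\dots,\mu_{d-1}$ are collision-free if the products $\mu_j\overline{\mu_k}$, $j,k\in\{0,\dots,d-1\}$, are pairwise distinct (for distinct ordered index pairs); they are absolutely collision-free if, in addition, the products $|\mu_j||\mu_k|$ for $j>k$ are pairwise distinct. With $\psi_i:=S^{-1}\phi_i$ (components $\psi_{i,k}$), the set $\{\phi_i\}_{i=0}^{J-1}$ allows parameter identification and phase retrieval if the following three properties hold. (i) Index separation: $\bigcup_{i=0}^{J-1}\operatorname{supp}\psi_i=\{0,\dots,d-1\}$, and for every $k\in\{0,\dots,d-1\}$ there exist index sets $\mathcal F_k,\mathcal G_k\subset\{0,\dots,J-1\}$ with $\{k\}=\bigcap_{i\in\mathcal F_k}\operatorname{supp}\psi_i\setminus\bigcup_{i\in\mathcal G_k}\operatorname{supp}\psi_i$. (ii) Phase propagation: $\#\bigl[\operatorname{supp}\psi_k\cap\bigcup_{i=0}^{k-1}\operatorname{supp}\psi_i\bigr]\ge2$ for $k=1,\dots,J-1$. (iii) Winding direction determination: there are indices $i_1,i_2,k_1,k_2$ such that $\psi_{i_1,k_1}\overline{\psi_{i_1,k_2}}$ and $\psi_{i_2,k_1}\overline{\psi_{i_2,k_2}}$ are non-zero and $\arg(\psi_{i_1,k_1}\overline{\psi_{i_1,k_2}})\not\equiv\arg(\psi_{i_2,k_1}\overline{\psi_{i_2,k_2}})\pmod\pi$.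 *)

theory Defs
  imports
    "Jordan_Normal_Form.Schur_Decomposition"
    "Jordan_Normal_Form.Gauss_Jordan_Elimination"
    "HOL-Library.Real_Mod"
begin

text \<open>
  Vectors in \<open>\<complex>\<^sup>d\<close> and \<open>d \<times> d\<close> matrices are those of Jordan_Normal_Form, indexed by
  \<open>0, \<dots>, d - 1\<close>. Families \<open>\<mu>\<^sub>0, \<dots>, \<mu>\<^sub>d\<^sub>-\<^sub>1\<close> and \<open>\<phi>\<^sub>0, \<dots>, \<phi>\<^sub>J\<^sub>-\<^sub>1\<close> are functions on \<open>nat\<close>, of which
  only the values below \<open>d\<close> and \<open>J\<close> are used.
\<close>

definition supp_vec :: "complex vec \<Rightarrow> nat set" where
  "supp_vec v = {k. k < dim_vec v \<and> v $ k \<noteq> 0}"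

text \<open>The inverse, unspecified for matrices that are not invertible.\<close>

definition inv_mat :: "complex mat \<Rightarrow> complex mat" where
  "inv_mat S = the (mat_inverse S)"

lemma inv_mat:
  assumes S: "S \<in> carrier_mat d d" and inv: "invertible_mat S"
  shows "inv_mat S \<in> carrier_mat d d" "S * inv_mat S = 1\<^sub>m d" "inv_mat S * S = 1\<^sub>m d"
proof -
  obtain B where B: "S * B = 1\<^sub>m (dim_row S)" "B * S = 1\<^sub>m (dim_row B)"
    using inv unfolding invertible_mat_def inverts_mat_def by blast
  have "dim_col (S * B) = d" "dim_col (B * S) = dim_row B"
    using B S by auto
  then have Bd: "B \<in> carrier_mat d d"
    using S by auto
  then have "S \<in> Units (ring_mat TYPE(complex) d ())"
    using B S unfolding Units_def ring_mat_def by auto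
  then obtain C where C: "mat_inverse S = Some C"
    using mat_inverse(1)[OF S, where b = "()"] by (cases "mat_inverse S") auto
  with mat_inverse(2)[OF S C]
  show "inv_mat S \<in> carrier_mat d d" "S * inv_mat S = 1\<^sub>m d" "inv_mat S * S = 1\<^sub>m d"
    unfolding inv_mat_def by auto
qed

definition collision_free :: "nat \<Rightarrow> (nat \<Rightarrow> complex) \<Rightarrow> bool" where
  "collision_free d \<mu> \<longleftrightarrow> inj_on (\<lambda>(j, k). \<mu> j * cnj (\<mu> k)) ({..<d} \<times> {..<d})"

definition absolutely_collision_free :: "nat \<Rightarrow> (nat \<Rightarrow> complex) \<Rightarrow> bool" where
  "absolutely_collision_free d \<mu> \<longleftrightarrow>
     collision_free d \<mu> \<and>
     inj_on (\<lambda>(j, k). cmod (\<mu> j) * cmod (\<mu> k)) {(j, k). j < d \<and> k < d \<and> j > k}"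

text \<open>
  The following three properties are stated for the transformed vectors
  \<open>\<psi>\<^sub>i = S\<^sup>-\<^sup>1 \<phi>\<^sub>i\<close>. The intersection is taken within the index set
  \<open>{..<d}\<close>, so that the intersection over the empty family is \<open>{..<d}\<close>.
\<close>

definition index_separation :: "nat \<Rightarrow> nat \<Rightarrow> (nat \<Rightarrow> complex vec) \<Rightarrow> bool" where
  "index_separation d J \<psi> \<longleftrightarrow>
     (\<Union>i<J. supp_vec (\<psi> i)) = {..<d} \<and>
     (\<forall>k<d. \<exists>F G. F \<subseteq> {..<J} \<and> G \<subseteq> {..<J} \<and>
        {k} = ({..<d} \<inter> (\<Inter>i\<in>F. supp_vec (\<psi> i))) - (\<Union>i\<in>G. supp_vec (\<psi> i)))"

definition phase_propagation :: "nat \<Rightarrow> (nat \<Rightarrow> complex vec) \<Rightarrow> bool" where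
  "phase_propagation J \<psi> \<longleftrightarrow>
     (\<forall>k. 1 \<le> k \<and> k < J \<longrightarrow> card (supp_vec (\<psi> k) \<inter> (\<Union>i<k. supp_vec (\<psi> i))) \<ge> 2)"

definition winding_direction_determination ::
    "nat \<Rightarrow> nat \<Rightarrow> (nat \<Rightarrow> complex vec) \<Rightarrow> bool" where
  "winding_direction_determination d J \<psi> \<longleftrightarrow>
     (\<exists>i1 i2 k1 k2. i1 < J \<and> i2 < J \<and> k1 < d \<and> k2 < d \<and>
        \<psi> i1 $ k1 * cnj (\<psi> i1 $ k2) \<noteq> 0 \<and>
        \<psi> i2 $ k1 * cnj (\<psi> i2 $ k2) \<noteq> 0 \<and>
        \<not> [Arg (\<psi> i1 $ k1 * cnj (\<psi> i1 $ k2)) = Arg (\<psi> i2 $ k1 * cnj (\<psi> i2 $ k2))] (rmod pi))"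

definition allows_identification_and_retrieval ::
    "nat \<Rightarrow> nat \<Rightarrow> complex mat \<Rightarrow> (nat \<Rightarrow> complex vec) \<Rightarrow> bool" where
  "allows_identification_and_retrieval d J S \<phi> \<longleftrightarrow>
     (let \<psi> = (\<lambda>i. inv_mat S *\<^sub>v \<phi> i) in
        index_separation d J \<psi> \<and> phase_propagation J \<psi> \<and> winding_direction_determination d J \<psi>)"

end

theory Submission
  imports Defs
begin

text \<open>
  Squaring a sample gives an exponential sum \<open>\<Sum> c\<^sub>j \<cdot> cnj c\<^sub>k \<cdot> (\<lambda>\<^sub>j \<cdot> cnj \<lambda>\<^sub>k)\<^sup>\<ell>\<close> with at most \<open>L\<^sub>i\<^sup>2\<close> distinct
  nodes, so \<open>2 L\<^sub>i\<^sup>2\<close> values determine nodes and coefficients. The real nodes are those with \<open>j = k\<close>;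
  they give the moduli, which index separation attaches to the right indices. Absolute
  collision-freeness then leaves, for each pair in a common support, only the choice between a node
  and its conjugate, i.e. between \<open>\<lambda>' / \<lambda>\<close> and \<open>\<lambda>' / cnj \<lambda>\<close> agreeing at the two indices, but never
  both. As a set cannot be the union of two proper equivalence relations, one choice is made on each
  support, and overlaps of two indices make it global. The conjugate choice would force
  \<open>\<psi>\<^sub>i\<^sub>,\<^sub>k \<cdot> cnj \<psi>\<^sub>i\<^sub>,\<^sub>m\<close> to have the same argument modulo \<open>\<pi>\<close> for all \<open>i\<close>, contrary to the third property.
\<close>

section \<open>Exponential sums\<close>

text \<open>Uniqueness behind Prony's method: both sums are tested against a polynomial that
  vanishes at every node of either sum except \<open>f p\<close>, which isolates the term at
  \<open>p\<close>.\<close>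

lemma exp_sum_determines_terms:
  fixes f f' a a' :: "'b \<Rightarrow> 'a :: field"
  assumes fin: "finite K" and inj: "inj_on f K" and inj': "inj_on f' K"
    and nz: "a p \<noteq> 0" and p: "p \<in> K"
    and eq: "\<And>l. l < 2 * card K \<Longrightarrow> (\<Sum>q\<in>K. a q * f q ^ l) = (\<Sum>q\<in>K. a' q * f' q ^ l)"
  shows "\<exists>q\<in>K. f' q = f p \<and> a' q = a p"
proof -
  \<comment> \<open>Leaving out \<open>f p\<close> keeps \<open>P\<close> nonzero there and brings
    its degree strictly below \<open>2 * card K\<close>, the number of known power sums.\<close>
  define Z where "Z = f ` K \<union> f' ` K - {f p}"
  define P where "P = (\<Prod>z\<in>Z. [:- z, 1:])"
  have finZ: "finite Z"
    using fin by (simp add: Z_def)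
  have "Z \<subset> f ` K \<union> f' ` K"
    using p by (auto simp: Z_def)
  then have "card Z < card (f ` K \<union> f' ` K)"
    using fin by (intro psubset_card_mono) auto
  also have "\<dots> \<le> card (f ` K) + card (f' ` K)"
    by (rule card_Un_le)
  also have "\<dots> \<le> 2 * card K"
    using card_image_le[OF fin, of f] card_image_le[OF fin, of f'] by simp
  finally have cardZ: "card Z < 2 * card K" .
  have "degree P \<le> (\<Sum>z\<in>Z. degree [:- z, 1:])"
    using degree_prod_sum_le[OF finZ, of "\<lambda>z. [:- z, 1:]"] by (simp add: P_def o_def)
  then have degP: "degree P < 2 * card K"
    using cardZ by simp
  have poly_P: "poly P z = 0 \<longleftrightarrow> z \<in> Z" for z
    using finZ by (auto simp: P_def poly_prod)
  have expand: "(\<Sum>q\<in>K. b q * poly P (g q)) =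
      (\<Sum>l\<le>degree P. coeff P l * (\<Sum>q\<in>K. b q * g q ^ l))" for b g
    by (simp add: poly_altdef sum_distrib_left ac_simps) (rule sum.swap)
  have "(\<Sum>q\<in>K. a q * poly P (f q)) = (\<Sum>q\<in>K. a' q * poly P (f' q))"
    unfolding expand using eq degP by simp
  also have "(\<Sum>q\<in>K. a q * poly P (f q)) = (\<Sum>q\<in>{p}. a q * poly P (f q))"
    using fin p inj by (intro sum.mono_neutral_right) (auto simp: poly_P Z_def inj_on_eq_iff)
  finally have sum': "(\<Sum>q\<in>K. a' q * poly P (f' q)) = a p * poly P (f p)"
    by simp
  have P_nz: "poly P (f p) \<noteq> 0"
    by (simp add: poly_P Z_def)
  have "\<exists>q\<in>K. f' q = f p"
  proof (rule ccontr)
    assume "\<not> ?thesis"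
    then have "(\<Sum>q\<in>K. a' q * poly P (f' q)) = 0"
      by (intro sum.neutral) (auto simp: poly_P Z_def)
    with sum' nz P_nz show False
      by simp
  qed
  then obtain q where q: "q \<in> K" "f' q = f p"
    by blast
  have "(\<Sum>r\<in>K. a' r * poly P (f' r)) = (\<Sum>r\<in>{q}. a' r * poly P (f' r))"
    using fin q inj' inj_onD[OF inj'] by (intro sum.mono_neutral_right) (auto simp: poly_P Z_def)
  with sum' q P_nz have "a' q = a p"
    by simp
  with q show ?thesis
    by blast
qed

section \<open>Collision-free families\<close>

lemma collision_freeD:
  assumes "collision_free d \<mu>" "j < d" "k < d" "m < d" "n < d"
    "\<mu> j * cnj (\<mu> k) = \<mu> m * cnj (\<mu> n)"
  shows "j = m" "k = n"
  using assms unfolding collision_free_def inj_on_def by fastforce+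

text \<open>A zero at \<open>k\<close> would give \<open>(j, k)\<close> and \<open>(k, j)\<close>
  the same product 0; \<open>d \<ge> 2\<close> supplies the second index.\<close>

lemma collision_free_nonzero:
  assumes "collision_free d \<mu>" "d \<ge> 2" "k < d"
  shows "\<mu> k \<noteq> 0"
proof
  assume "\<mu> k = 0"
  obtain j where "j < d" "j \<noteq> k"
    using \<open>d \<ge> 2\<close> by (cases "k = 0") (auto intro: that[of 0] that[of 1])
  then show False
    using collision_freeD(1)[OF assms(1), of j k k j] \<open>\<mu> k = 0\<close> assms by simp
qed

lemma collision_free_cmod_inj:
  assumes "collision_free d \<mu>" "j < d" "k < d" "cmod (\<mu> j) = cmod (\<mu> k)"
  shows "j = k"
  using collision_freeD(1)[of d \<mu> j j k k] assms by (simp add: complex_norm_square[symmetric])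

text \<open>The definition only compares pairs with \<open>j > k\<close>; sorting by
  \<open>max\<close> and \<open>min\<close> brings arbitrary off-diagonal pairs into that range, at
  the cost of their order.\<close>

lemma absolutely_collision_free_unordered:
  assumes "absolutely_collision_free d \<mu>" "j < d" "k < d" "m < d" "n < d" "j \<noteq> k" "m \<noteq> n"
    "cmod (\<mu> j) * cmod (\<mu> k) = cmod (\<mu> m) * cmod (\<mu> n)"
  shows "j = m \<and> k = n \<or> j = n \<and> k = m"
proof -
  have inj: "inj_on (\<lambda>(j, k). cmod (\<mu> j) * cmod (\<mu> k)) {(j, k). j < d \<and> k < d \<and> j > k}"
    using assms(1) by (simp add: absolutely_collision_free_def)
  have "(max j k, min j k) = (max m n, min m n)"
    by (rule inj_onD[OF inj])
      (use assms in \<open>auto simp: max_def min_def mult.commute split: if_splits\<close>)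
  then show ?thesis
    by (auto simp: max_def min_def split: if_splits)
qed

section \<open>Matching the samples of a single vector\<close>

text \<open>In the application \<open>I\<close> is the support of one transformed vector and
  \<open>c k\<close> its entry times \<open>cnj (y k)\<close>. The range of \<open>l\<close> is
  twice the number of pairs in \<open>I \<times> I\<close>, as
  \<open>exp_sum_determines_terms\<close> requires.\<close>

locale matching_samples =
  fixes d :: nat and I :: "nat set" and \<mu> \<mu>' c c' :: "nat \<Rightarrow> complex"
  assumes I_subset: "I \<subseteq> {..<d}"
    and cf: "collision_free d \<mu>" and cf': "collision_free d \<mu>'"
    and c_nz: "\<And>k. k \<in> I \<Longrightarrow> c k \<noteq> 0" and c'_nz: "\<And>k. k \<in> I \<Longrightarrow> c' k \<noteq> 0"
    and samples: "\<And>l. l < 2 * (card I)\<^sup>2 \<Longrightarrow>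
      cmod (\<Sum>k\<in>I. c' k * \<mu>' k ^ l) = cmod (\<Sum>k\<in>I. c k * \<mu> k ^ l)"
begin

text \<open>The hypotheses are symmetric, so every matching result can also be read from the primed
  to the unprimed family.\<close>

lemma swap: "matching_samples d I \<mu>' \<mu> c' c"
  using I_subset cf cf' c_nz c'_nz samples by unfold_locales auto

lemma less_d: "k \<in> I \<Longrightarrow> k < d"
  using I_subset by auto

text \<open>The squared samples are exponential sums indexed by \<open>I \<times> I\<close>, with
  distinct nodes by collision-freeness and nonzero coefficients.\<close>

lemma match_nodes:
  assumes "j \<in> I" "k \<in> I"
  obtains m n where "m \<in> I" "n \<in> I" "\<mu>' m * cnj (\<mu>' n) = \<mu> j * cnj (\<mu> k)"
    "c' m * cnj (c' n) = c j * cnj (c k)"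
proof -
  have fin: "finite I"
    using I_subset finite_subset by blast
  have square: "(\<Sum>p\<in>I \<times> I. (case p of (j, k) \<Rightarrow> b j * cnj (b k)) *
      (case p of (j, k) \<Rightarrow> g j * cnj (g k)) ^ l) = of_real ((cmod (\<Sum>k\<in>I. b k * g k ^ l))\<^sup>2)"
    for b g :: "nat \<Rightarrow> complex" and l
    unfolding complex_norm_square
    by (simp add: sum_product sum.cartesian_product power_mult_distrib case_prod_beta ac_simps)
  have inj: "inj_on (\<lambda>(j, k). g j * cnj (g k)) (I \<times> I)" if "collision_free d g" for g
    by (rule inj_on_subset[OF that[unfolded collision_free_def]]) (use I_subset in auto)
  have "\<exists>q\<in>I \<times> I. (case q of (j, k) \<Rightarrow> \<mu>' j * cnj (\<mu>' k)) = (case (j, k) of (j, k) \<Rightarrow> \<mu> j * cnj (\<mu> k))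
      \<and> (case q of (j, k) \<Rightarrow> c' j * cnj (c' k)) = (case (j, k) of (j, k) \<Rightarrow> c j * cnj (c k))"
  proof (rule exp_sum_determines_terms)
    fix l
    assume "l < 2 * card (I \<times> I)"
    then have "l < 2 * (card I)\<^sup>2"
      by (simp add: card_cartesian_product power2_eq_square)
    then show "(\<Sum>p\<in>I \<times> I. (case p of (j, k) \<Rightarrow> c j * cnj (c k)) *
        (case p of (j, k) \<Rightarrow> \<mu> j * cnj (\<mu> k)) ^ l) =
      (\<Sum>p\<in>I \<times> I. (case p of (j, k) \<Rightarrow> c' j * cnj (c' k)) *
        (case p of (j, k) \<Rightarrow> \<mu>' j * cnj (\<mu>' k)) ^ l)"
      unfolding square by (simp add: samples)
  qed (use fin assms c_nz inj cf cf' in auto)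
  then show thesis
    using that by auto
qed

lemma match_modulus:
  assumes "k \<in> I"
  shows "\<exists>m\<in>I. cmod (\<mu>' m) = cmod (\<mu> k) \<and> cmod (c' m) = cmod (c k)"
proof -
  obtain m n where mn: "m \<in> I" "n \<in> I" "\<mu>' m * cnj (\<mu>' n) = \<mu> k * cnj (\<mu> k)"
    "c' m * cnj (c' n) = c k * cnj (c k)"
    using match_nodes[OF assms assms] by metis
  \<comment> \<open>The matched node is real, hence invariant under exchanging \<open>m\<close> and
    \<open>n\<close>; collision-freeness allows this only on the diagonal.\<close>
  have "\<mu>' n * cnj (\<mu>' m) = cnj (\<mu>' m * cnj (\<mu>' n))"
    by simp
  also have "\<dots> = \<mu>' m * cnj (\<mu>' n)"
    by (simp add: mn(3) mult.commute)
  finally have "n = m"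
    using collision_freeD(1)[OF cf'] mn less_d by blast
  with mn have "(cmod (\<mu>' m))\<^sup>2 = (cmod (\<mu> k))\<^sup>2" "(cmod (c' m))\<^sup>2 = (cmod (c k))\<^sup>2"
    by (simp_all only: complex_norm_square[symmetric] of_real_eq_iff)
  with mn show ?thesis
    by (intro bexI[of _ m]) simp_all
qed

text \<open>Taking moduli in a matched node gives \<open>cmod (\<mu>' m) * cmod (\<mu>' n) = cmod
  (\<mu>' j) * cmod (\<mu>' k)\<close>, which fixes the unordered pair; its order stays open, hence
  the two alternatives.\<close>

lemma match_off_diagonal:
  assumes acf': "absolutely_collision_free d \<mu>'"
    and moduli: "\<And>k. k < d \<Longrightarrow> cmod (\<mu>' k) = cmod (\<mu> k)"
    and "j \<in> I" "k \<in> I" "j \<noteq> k"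
  shows "\<mu>' j * cnj (\<mu>' k) = \<mu> j * cnj (\<mu> k) \<and> c' j * cnj (c' k) = c j * cnj (c k) \<or>
    \<mu>' k * cnj (\<mu>' j) = \<mu> j * cnj (\<mu> k) \<and> c' k * cnj (c' j) = c j * cnj (c k)"
proof -
  obtain m n where mn: "m \<in> I" "n \<in> I" "\<mu>' m * cnj (\<mu>' n) = \<mu> j * cnj (\<mu> k)"
    "c' m * cnj (c' n) = c j * cnj (c k)"
    using match_nodes[OF assms(3,4)] by metis
  \<comment> \<open>A diagonal node is real, whereas \<open>\<mu> j * cnj (\<mu> k)\<close> with
    \<open>j \<noteq> k\<close> is not.\<close>
  have "m \<noteq> n"
  proof
    assume "m = n"
    have "\<mu> k * cnj (\<mu> j) = cnj (\<mu>' m * cnj (\<mu>' n))"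
      by (simp add: mn(3))
    also have "\<dots> = \<mu>' m * cnj (\<mu>' n)"
      by (simp add: \<open>m = n\<close>)
    finally have "\<mu> k * cnj (\<mu> j) = \<mu> j * cnj (\<mu> k)"
      by (simp only: mn(3))
    then show False
      using collision_freeD(1)[OF cf] less_d assms(3-5) by blast
  qed
  have "cmod (\<mu>' m) * cmod (\<mu>' n) = cmod (\<mu>' j) * cmod (\<mu>' k)"
    using arg_cong[OF mn(3), of cmod] moduli less_d assms(3,4) by (simp add: norm_mult)
  then have "m = j \<and> n = k \<or> m = k \<and> n = j"
    using absolutely_collision_free_unordered[OF acf'] less_d mn(1,2) assms(3,4) \<open>m \<noteq> n\<close> \<open>j \<noteq> k\<close>
    by blast
  with mn show ?thesis
    by blast
qed

end

section \<open>Propagation along overlapping supports\<close>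

lemma constant_on_Un:
  assumes "\<exists>c. \<forall>j\<in>A. f j = c" "\<exists>c. \<forall>j\<in>B. f j = c" "A \<inter> B \<noteq> {}"
  shows "\<exists>c. \<forall>j\<in>A \<union> B. f j = c"
proof -
  obtain c c' where "\<forall>j\<in>A. f j = c" "\<forall>j\<in>B. f j = c'"
    using assms(1,2) by blast
  moreover from this have "c = c'"
    using assms(3) by auto
  ultimately show ?thesis
    by blast
qed

lemma two_functions_constant:
  assumes "\<And>j k. j \<in> A \<Longrightarrow> k \<in> A \<Longrightarrow> f j = f k \<or> g j = g k"
  shows "(\<exists>c. \<forall>j\<in>A. f j = c) \<or> (\<exists>c. \<forall>j\<in>A. g j = c)"
proof (rule disjCI)
  assume "\<nexists>c. \<forall>j\<in>A. g j = c"
  then show "\<exists>c. \<forall>j\<in>A. f j = c"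
  proof (cases "A = {}")
    case False
    then obtain a where "a \<in> A"
      by blast
    with \<open>\<nexists>c. \<forall>j\<in>A. g j = c\<close> obtain b where b: "b \<in> A" "g b \<noteq> g a"
      by blast
    \<comment> \<open>\<open>g j\<close> differs from \<open>g a\<close> or from \<open>g b\<close>,
      so \<open>f j\<close> equals \<open>f a\<close> or \<open>f b\<close>; these two agree because
      \<open>g b \<noteq> g a\<close>.\<close>
    have "f j = f a" if "j \<in> A" for j
      using assms[OF that \<open>a \<in> A\<close>] assms[OF that b(1)] assms[OF b(1) \<open>a \<in> A\<close>] b(2) by auto
    then show ?thesis
      by blast
  qed simp
qed

lemma constant_on_overlapping_union:
  fixes I :: "nat \<Rightarrow> 'a set"
  assumes overlap: "\<And>k. 1 \<le> k \<Longrightarrow> k < J \<Longrightarrow> I k \<inter> (\<Union>i<k. I i) \<noteq> {}"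
    and const: "\<And>i. i < J \<Longrightarrow> \<exists>c. \<forall>j\<in>I i. f j = c"
  shows "\<exists>c. \<forall>j\<in>(\<Union>i<J. I i). f j = c"
proof -
  have "n \<le> J \<Longrightarrow> \<exists>c. \<forall>j\<in>(\<Union>i<n. I i). f j = c" for n
  proof (induction n)
    case (Suc n)
    show ?case
    proof (cases "n = 0")
      case True
      then show ?thesis
        using const[of 0] Suc.prems by (simp add: lessThan_Suc)
    next
      case False
      then show ?thesis
        using constant_on_Un[OF const[of n] Suc.IH] overlap[of n] Suc.prems
        by (simp add: lessThan_Suc)
    qed
  qed simp
  then show ?thesis
    by simp
qed

text \<open>One shared index would not stop \<open>f\<close> being constant on one set and
  \<open>g\<close> on the next. Two shared indices do: both functions would agree there, against
  \<open>not_both\<close>.\<close>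

lemma either_constant_on_overlapping_union:
  fixes I :: "nat \<Rightarrow> 'a set"
  assumes overlap: "\<And>k. 1 \<le> k \<Longrightarrow> k < J \<Longrightarrow> card (I k \<inter> (\<Union>i<k. I i)) \<ge> 2"
    and either: "\<And>i j k. i < J \<Longrightarrow> j \<in> I i \<Longrightarrow> k \<in> I i \<Longrightarrow> f j = f k \<or> g j = g k"
    and not_both: "\<And>i j k. i < J \<Longrightarrow> j \<in> I i \<Longrightarrow> k \<in> I i \<Longrightarrow> f j = f k \<Longrightarrow> g j = g k \<Longrightarrow> j = k"
  shows "(\<exists>c. \<forall>j\<in>(\<Union>i<J. I i). f j = c) \<or> (\<exists>c. \<forall>j\<in>(\<Union>i<J. I i). g j = c)"
proof -
  have "n \<le> J \<Longrightarrow> (\<exists>c. \<forall>j\<in>(\<Union>i<n. I i). f j = c) \<or> (\<exists>c. \<forall>j\<in>(\<Union>i<n. I i). g j = c)" for n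
  proof (induction n)
    case (Suc n)
    have n: "n < J"
      using Suc.prems by simp
    have last: "(\<exists>c. \<forall>j\<in>I n. f j = c) \<or> (\<exists>c. \<forall>j\<in>I n. g j = c)"
      using either[OF n] by (rule two_functions_constant)
    have union: "(\<Union>i<Suc n. I i) = I n \<union> (\<Union>i<n. I i)"
      by (auto simp: lessThan_Suc)
    show ?case
    proof (cases "n = 0")
      case True
      then show ?thesis
        using last by (simp add: lessThan_Suc)
    next
      case False
      then have two: "card (I n \<inter> (\<Union>i<n. I i)) \<ge> 2"
        using overlap n by simp
      then have "\<not> is_singleton (I n \<inter> (\<Union>i<n. I i))" "I n \<inter> (\<Union>i<n. I i) \<noteq> {}"
        by (auto simp: is_singleton_altdef)
      then obtain a b where ab: "a \<noteq> b" "a \<in> I n \<inter> (\<Union>i<n. I i)" "b \<in> I n \<inter> (\<Union>i<n. I i)"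
        by (metis is_singletonI')
      have not_both_ab: "\<not> (f a = f b \<and> g a = g b)"
        using not_both[OF n] ab by blast
      have same_f: "f a = f b" if "\<exists>c. \<forall>j\<in>A. f j = c" "a \<in> A" "b \<in> A" for A
        using that by auto
      have same_g: "g a = g b" if "\<exists>c. \<forall>j\<in>A. g j = c" "a \<in> A" "b \<in> A" for A
        using that by auto
      have "(\<exists>c. \<forall>j\<in>(\<Union>i<n. I i). f j = c) \<or> (\<exists>c. \<forall>j\<in>(\<Union>i<n. I i). g j = c)"
        using Suc by simp
      with last show ?thesis
      proof (elim disjE)
        assume "\<exists>c. \<forall>j\<in>I n. f j = c" "\<exists>c. \<forall>j\<in>(\<Union>i<n. I i). f j = c"
        then have "\<exists>c. \<forall>j\<in>(\<Union>i<Suc n. I i). f j = c"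
          unfolding union by (rule constant_on_Un) (use ab in blast)
        then show ?thesis ..
      next
        assume "\<exists>c. \<forall>j\<in>I n. g j = c" "\<exists>c. \<forall>j\<in>(\<Union>i<n. I i). g j = c"
        then have "\<exists>c. \<forall>j\<in>(\<Union>i<Suc n. I i). g j = c"
          unfolding union by (rule constant_on_Un) (use ab in blast)
        then show ?thesis ..
      next
        \<comment> \<open>In the two mixed cases \<open>a\<close> and \<open>b\<close> agree under
          one function through \<open>I n\<close> and under the other through the earlier
          union.\<close>
        assume "\<exists>c. \<forall>j\<in>I n. f j = c" "\<exists>c. \<forall>j\<in>(\<Union>i<n. I i). g j = c"
        then show ?thesis
          using same_f[of "I n"] same_g[of "\<Union>i<n. I i"] not_both_ab ab(2,3) by (meson IntE)
      next
        assume "\<exists>c. \<forall>j\<in>I n. g j = c" "\<exists>c. \<forall>j\<in>(\<Union>i<n. I i). f j = c"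
        then show ?thesis
          using same_g[of "I n"] same_f[of "\<Union>i<n. I i"] not_both_ab ab(2,3) by (meson IntE)
      qed
    qed
  qed simp
  then show ?thesis
    by simp
qed

section \<open>Ratios and arguments of complex numbers\<close>

text \<open>Equal moduli give \<open>b' * cnj b' = b * cnj b\<close>, so
  \<open>cnj b / cnj b' = b' / b\<close>. A relation between pairs thus becomes equality of one
  ratio at two indices, which propagates.\<close>

lemma product_cnj_eq_iff:
  fixes a b a' b' :: complex
  assumes "a \<noteq> 0" "b \<noteq> 0" "cmod b' = cmod b"
  shows "a' * cnj b' = a * cnj b \<longleftrightarrow> a' / a = b' / b"
proof -
  have "b' * cnj b' = b * cnj b"
    using assms(3) by (metis complex_norm_square)
  moreover have "b' \<noteq> 0"
    using assms by auto
  ultimately show ?thesis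
    using assms by (simp add: field_simps) (smt (verit) complex_cnj_zero_iff mult.assoc mult.commute mult_cancel_left)
qed

text \<open>The last hypothesis says that \<open>u * cnj v\<close> is real, so the sine of the
  difference of the arguments vanishes.\<close>

lemma Arg_rcong_pi:
  assumes "u \<noteq> 0" "v \<noteq> 0" "u * cnj v = cnj u * v"
  shows "[Arg u = Arg v] (rmod pi)"
proof -
  have "Im (u * cnj v) = 0"
    using assms(3) by (simp add: complex_eq_iff)
  moreover have "u * cnj v = rcis (cmod u * cmod v) (Arg u - Arg v)"
    by (metis rcis_cmod_Arg rcis_cnj rcis_mult uminus_add_conv_diff add.commute)
  ultimately have "sin (Arg u - Arg v) = 0"
    using assms by simp
  then obtain n :: int where n: "Arg u - Arg v = of_int n * pi"
    by (auto simp: sin_zero_iff_int2)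
  then show ?thesis
    unfolding rcong_altdef by (intro exI[of _ "- n"]) (simp add: algebra_simps)
qed

section \<open>Identification\<close>

text \<open>Some \<open>\<mu>' m\<close> has the modulus of \<open>\<mu> k\<close>. The indices
  \<open>m\<close> and \<open>k\<close> turn out to lie in exactly the same supports, so index
  separation identifies them.\<close>

lemma eigenvalue_moduli_determined:
  assumes sep: "index_separation d J \<psi>"
    and match: "\<And>i. i < J \<Longrightarrow> matching_samples d (supp_vec (\<psi> i)) \<mu> \<mu>' (c i) (c' i)"
    and cf: "collision_free d \<mu>" and cf': "collision_free d \<mu>'"
    and k: "k < d"
  shows "cmod (\<mu>' k) = cmod (\<mu> k)"
proof -
  let ?I = "\<lambda>i. supp_vec (\<psi> i)"
  obtain i where i: "i < J" "k \<in> ?I i"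
    using conjunct1[OF sep[unfolded index_separation_def]] k by blast
  obtain m where m: "m \<in> ?I i" "cmod (\<mu>' m) = cmod (\<mu> k)"
    using matching_samples.match_modulus[OF match[OF i(1)] i(2)] by blast
  have m_d: "m < d"
    using m matching_samples.less_d[OF match[OF i(1)]] by blast
  \<comment> \<open>The common modulus is visible in the \<open>n\<close>-th samples of both
    families or of neither; moduli being distinct within a family, it marks \<open>m\<close> on one
    side and \<open>k\<close> on the other.\<close>
  have same: "m \<in> ?I n \<longleftrightarrow> k \<in> ?I n" if n: "n < J" for n
  proof
    assume "m \<in> ?I n"
    then obtain j where j: "j \<in> ?I n" "cmod (\<mu> j) = cmod (\<mu>' m)"
      using matching_samples.match_modulus[OF matching_samples.swap[OF match[OF n]]] by blast
    then have "j = k"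
      using collision_free_cmod_inj[OF cf _ k] m matching_samples.less_d[OF match[OF n]] by simp
    with j show "k \<in> ?I n"
      by simp
  next
    assume "k \<in> ?I n"
    then obtain j where j: "j \<in> ?I n" "cmod (\<mu>' j) = cmod (\<mu> k)"
      using matching_samples.match_modulus[OF match[OF n]] by blast
    then have "j = m"
      using collision_free_cmod_inj[OF cf' _ m_d] m matching_samples.less_d[OF match[OF n]] by simp
    with j show "m \<in> ?I n"
      by simp
  qed
  obtain F G where FG: "F \<subseteq> {..<J}" "G \<subseteq> {..<J}"
    "{k} = ({..<d} \<inter> (\<Inter>i\<in>F. ?I i)) - (\<Union>i\<in>G. ?I i)"
    using conjunct2[OF sep[unfolded index_separation_def], rule_format, OF k] by (elim exE conjE)
  have "k \<in> ({..<d} \<inter> (\<Inter>i\<in>F. ?I i)) - (\<Union>i\<in>G. ?I i)"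
    by (subst FG(3)[symmetric]) simp
  moreover have "m \<in> ?I n \<longleftrightarrow> k \<in> ?I n" if "n \<in> F \<union> G" for n
    using same FG(1,2) that by auto
  ultimately have "m \<in> ({..<d} \<inter> (\<Inter>i\<in>F. ?I i)) - (\<Union>i\<in>G. ?I i)"
    using m_d by simp
  then have "m \<in> {k}"
    by (subst FG(3))
  then have "m = k"
    by simp
  with m show ?thesis
    by simp
qed

text \<open>The identification result in eigenvector coordinates, with \<open>y\<close> and
  \<open>y'\<close> in the role of the adjoint of \<open>S\<close> applied to the two
  signals.\<close>

lemma spectrum_and_coordinates_determined:
  assumes d: "d \<ge> 2"
    and sep: "index_separation d J \<psi>" and propag: "phase_propagation J \<psi>"
    and wind: "winding_direction_determination d J \<psi>"
    and dim: "\<And>i. i < J \<Longrightarrow> dim_vec (\<psi> i) = d"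
    and acf: "absolutely_collision_free d \<mu>" and acf': "absolutely_collision_free d \<mu>'"
    and y: "\<And>k. k < d \<Longrightarrow> y k \<noteq> 0" and y': "\<And>k. k < d \<Longrightarrow> y' k \<noteq> 0"
    and samples: "\<And>i l. i < J \<Longrightarrow> l < 2 * (card (supp_vec (\<psi> i)))\<^sup>2 \<Longrightarrow>
      cmod (\<Sum>k\<in>supp_vec (\<psi> i). (\<psi> i $ k * cnj (y' k)) * \<mu>' k ^ l) =
      cmod (\<Sum>k\<in>supp_vec (\<psi> i). (\<psi> i $ k * cnj (y k)) * \<mu> k ^ l)"
  obtains \<rho> \<tau> where "cmod \<rho> = 1" "cmod \<tau> = 1"
    "\<And>k. k < d \<Longrightarrow> \<mu>' k = \<rho> * \<mu> k" "\<And>k. k < d \<Longrightarrow> y' k = \<tau> * y k"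
proof -
  let ?I = "\<lambda>i. supp_vec (\<psi> i)"
  have cf: "collision_free d \<mu>" and cf': "collision_free d \<mu>'"
    using acf acf' unfolding absolutely_collision_free_def by blast+
  have cover: "(\<Union>i<J. ?I i) = {..<d}"
    using sep unfolding index_separation_def by (rule conjunct1)
  have match: "matching_samples d (?I i) \<mu> \<mu>' (\<lambda>k. \<psi> i $ k * cnj (y k)) (\<lambda>k. \<psi> i $ k * cnj (y' k))"
    if i: "i < J" for i
  proof
    show "?I i \<subseteq> {..<d}"
      using cover i by blast
    show "\<psi> i $ k * cnj (y k) \<noteq> 0" "\<psi> i $ k * cnj (y' k) \<noteq> 0" if "k \<in> ?I i" for k
      using that y y' dim[OF i] by (simp_all add: supp_vec_def)
  qed (use cf cf' samples[OF i] in simp_all)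
  have less_d: "k < d" if "i < J" "k \<in> ?I i" for i k
    using cover that by blast
  have \<mu>_nz: "\<mu> k \<noteq> 0" if "k < d" for k
    using collision_free_nonzero[OF cf d that] .
  have \<mu>_mod: "cmod (\<mu>' k) = cmod (\<mu> k)" if "k < d" for k
    using eigenvalue_moduli_determined[OF sep match cf cf' that] .
  have y_mod: "cmod (y' k) = cmod (y k)" if "k < d" for k
  proof -
    obtain i where i: "i < J" "k \<in> ?I i"
      using cover \<open>k < d\<close> by blast
    obtain m where m: "m \<in> ?I i" "cmod (\<mu>' m) = cmod (\<mu> k)"
      "cmod (\<psi> i $ m * cnj (y' m)) = cmod (\<psi> i $ k * cnj (y k))"
      using matching_samples.match_modulus[OF match[OF i(1)] i(2)] by blast
    have "m = k"
      using collision_free_cmod_inj[OF cf'] m \<mu>_mod less_d i that by metis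
    with m i show ?thesis
      by (simp add: norm_mult supp_vec_def)
  qed
  \<comment> \<open>Constancy of \<open>f\<close> means a rotated spectrum, constancy of
    \<open>g\<close> a rotated complex conjugate of it.\<close>
  define f where "f k = \<mu>' k / \<mu> k" for k
  define g where "g k = \<mu>' k / cnj (\<mu> k)" for k
  have f_eq: "f j = f k \<longleftrightarrow> \<mu>' j * cnj (\<mu>' k) = \<mu> j * cnj (\<mu> k)" if "j < d" "k < d" for j k
    unfolding f_def using product_cnj_eq_iff[of "\<mu> j" "\<mu> k" "\<mu>' k" "\<mu>' j"] \<mu>_nz \<mu>_mod that by auto
  have g_eq: "g j = g k \<longleftrightarrow> \<mu>' j * cnj (\<mu>' k) = \<mu> k * cnj (\<mu> j)" if "j < d" "k < d" for j k
    unfolding g_def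
    using product_cnj_eq_iff[of "cnj (\<mu> j)" "cnj (\<mu> k)" "\<mu>' k" "\<mu>' j"] \<mu>_nz \<mu>_mod that
    by (auto simp: mult.commute)
  \<comment> \<open>Both agreements together would make \<open>\<mu> j * cnj (\<mu> k)\<close>
    real.\<close>
  have not_both: "j = k" if "j < d" "k < d" "f j = f k" "g j = g k" for j k
    using f_eq g_eq collision_freeD(1)[OF cf, of j k k j] that by simp
  have pair: "f j = f k \<and> \<psi> i $ j * cnj (y' j) * cnj (\<psi> i $ k * cnj (y' k)) =
        \<psi> i $ j * cnj (y j) * cnj (\<psi> i $ k * cnj (y k)) \<or>
      g j = g k \<and> \<psi> i $ k * cnj (y' k) * cnj (\<psi> i $ j * cnj (y' j)) =
        \<psi> i $ j * cnj (y j) * cnj (\<psi> i $ k * cnj (y k))"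
    if i: "i < J" and jk: "j \<in> ?I i" "k \<in> ?I i" "j \<noteq> k" for i j k
    using matching_samples.match_off_diagonal[OF match[OF i] acf' \<mu>_mod jk] f_eq
      g_eq[of k j] less_d[OF i] jk(1,2) by metis
  have "(\<exists>c. \<forall>j\<in>(\<Union>i<J. ?I i). f j = c) \<or> (\<exists>c. \<forall>j\<in>(\<Union>i<J. ?I i). g j = c)"
  proof (rule either_constant_on_overlapping_union)
    show "f j = f k \<or> g j = g k" if "i < J" "j \<in> ?I i" "k \<in> ?I i" for i j k
      using pair that by (cases "j = k") auto
    show "j = k" if "i < J" "j \<in> ?I i" "k \<in> ?I i" "f j = f k" "g j = g k" for i j k
      using not_both[OF less_d less_d] that by blast
  qed (use propag in \<open>simp add: phase_propagation_def\<close>)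
  \<comment> \<open>The winding condition now excludes the conjugate spectrum.\<close>
  moreover have "\<nexists>c. \<forall>j\<in>(\<Union>i<J. ?I i). g j = c"
  proof
    assume "\<exists>c. \<forall>j\<in>(\<Union>i<J. ?I i). g j = c"
    then have g_const: "g j = g k" if "j < d" "k < d" for j k
      using that unfolding cover by auto
    obtain i1 i2 k1 k2 where w: "i1 < J" "i2 < J" "k1 < d" "k2 < d"
      "\<psi> i1 $ k1 * cnj (\<psi> i1 $ k2) \<noteq> 0" "\<psi> i2 $ k1 * cnj (\<psi> i2 $ k2) \<noteq> 0"
      "\<not> [Arg (\<psi> i1 $ k1 * cnj (\<psi> i1 $ k2)) = Arg (\<psi> i2 $ k1 * cnj (\<psi> i2 $ k2))] (rmod pi)"
      using wind unfolding winding_direction_determination_def by blast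
    have "k1 \<noteq> k2"
      using w(5-7) Arg_rcong_pi[of "\<psi> i1 $ k1 * cnj (\<psi> i1 $ k2)" "\<psi> i2 $ k1 * cnj (\<psi> i2 $ k2)"]
      by (auto simp: mult.commute)
    \<comment> \<open>Constant \<open>g\<close> forces \<open>f k2 \<noteq> f k1\<close>, leaving
      the second alternative of \<open>pair\<close>. The factors in \<open>y\<close> and
      \<open>y'\<close> do not depend on \<open>i\<close>, so the equations for \<open>i1\<close>
      and \<open>i2\<close> can be combined.\<close>
    have reflected: "(\<psi> i $ k1 * cnj (\<psi> i $ k2)) * (cnj (y' k1) * y' k2) =
        cnj (\<psi> i $ k1 * cnj (\<psi> i $ k2)) * (y k1 * cnj (y k2))"
      if "i < J" "\<psi> i $ k1 * cnj (\<psi> i $ k2) \<noteq> 0" for i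
    proof -
      have "k1 \<in> ?I i" "k2 \<in> ?I i"
        using that w dim by (auto simp: supp_vec_def)
      moreover have "f k2 \<noteq> f k1"
        using not_both w(3,4) g_const \<open>k1 \<noteq> k2\<close> by metis
      ultimately show ?thesis
        using pair[OF that(1), of k2 k1] \<open>k1 \<noteq> k2\<close> by (simp add: ac_simps)
    qed
    define a where "a = cnj (y' k1) * y' k2"
    define b where "b = y k1 * cnj (y k2)"
    define u where "u = \<psi> i1 $ k1 * cnj (\<psi> i1 $ k2)"
    define v where "v = \<psi> i2 $ k1 * cnj (\<psi> i2 $ k2)"
    have ab: "a \<noteq> 0" "b \<noteq> 0"
      using y y' w(3,4) by (auto simp: a_def b_def)
    have uv: "u * a = cnj u * b" "v * a = cnj v * b"
      using reflected w by (auto simp: a_def b_def u_def v_def)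
    \<comment> \<open>Multiplying the first equation by the conjugate-side of the second eliminates
      \<open>a\<close> and \<open>b\<close> and shows that \<open>u * cnj v\<close> is real.\<close>
    have "(a * b) * (u * cnj v) = (u * a) * (cnj v * b)"
      by (simp add: ac_simps)
    also have "\<dots> = (cnj u * b) * (v * a)"
      by (simp only: uv)
    also have "\<dots> = (a * b) * (cnj u * v)"
      by (simp add: ac_simps)
    finally have "u * cnj v = cnj u * v"
      using ab by simp
    then show False
      using Arg_rcong_pi[of u v] w by (simp add: u_def v_def)
  qed
  ultimately obtain \<rho> where "\<forall>j\<in>(\<Union>i<J. ?I i). f j = \<rho>"
    by blast
  then have \<rho>: "f j = \<rho>" if "j < d" for j
    using that unfolding cover by auto
  define h where "h k = y' k / y k" for k
  have "\<exists>\<tau>. \<forall>j\<in>(\<Union>i<J. ?I i). h j = \<tau>"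
  proof (rule constant_on_overlapping_union)
    fix k
    assume "1 \<le> k" "k < J"
    then have "card (?I k \<inter> (\<Union>i<k. ?I i)) \<ge> 2"
      using propag by (simp add: phase_propagation_def)
    then show "?I k \<inter> (\<Union>i<k. ?I i) \<noteq> {}"
      by auto
  next
    fix i
    assume i: "i < J"
    have "h j = h k" if jk: "j \<in> ?I i" "k \<in> ?I i" for j k
    proof (cases "j = k")
      case False
      have jk_d: "j < d" "k < d"
        using less_d[OF i] jk by auto
      \<comment> \<open>With \<open>f\<close> constant, only the unreflected alternative of
        \<open>pair\<close> survives; its coefficient equation, divided by the entries of
        \<open>\<psi> i\<close>, gives equal ratios \<open>h\<close>.\<close>
      then have "g j \<noteq> g k"
        using not_both \<rho> False by metis
      then have "\<psi> i $ j * cnj (y' j) * cnj (\<psi> i $ k * cnj (y' k)) =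
          \<psi> i $ j * cnj (y j) * cnj (\<psi> i $ k * cnj (y k))"
        using pair[OF i jk False] by blast
      then have "y' k * cnj (y' j) = y k * cnj (y j)"
        using jk by (simp add: supp_vec_def ac_simps)
      then show ?thesis
        unfolding h_def using product_cnj_eq_iff[of "y k" "y j" "y' j" "y' k"] y y_mod jk_d by simp
    qed simp
    then show "\<exists>c. \<forall>j\<in>?I i. h j = c"
      by blast
  qed
  then obtain \<tau> where "\<forall>j\<in>(\<Union>i<J. ?I i). h j = \<tau>"
    by blast
  then have \<tau>: "h j = \<tau>" if "j < d" for j
    using that unfolding cover by auto
  have "0 < d"
    using d by simp
  show thesis
  proof
    show "cmod \<rho> = 1" "cmod \<tau> = 1"
      using \<rho>[OF \<open>0 < d\<close>] \<tau>[OF \<open>0 < d\<close>] \<mu>_mod \<mu>_nz y y_mod \<open>0 < d\<close>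
      by (auto simp: f_def h_def norm_divide)
    show "\<mu>' k = \<rho> * \<mu> k" "y' k = \<tau> * y k" if "k < d" for k
      using \<rho>[OF that] \<tau>[OF that] \<mu>_nz[OF that] y[OF that] by (auto simp: f_def h_def)
  qed
qed

section \<open>Translation to the eigenvector basis\<close>

lemma mat_diag_pow: "mat_diag n f ^\<^sub>m l = mat_diag n (\<lambda>k. f k ^ l)"
proof (induction l)
  case (Suc l)
  have "mat_diag n f ^\<^sub>m Suc l = mat_diag n (\<lambda>k. f k ^ l) * mat_diag n f"
    by (simp only: pow_mat.simps Suc.IH)
  also have "\<dots> = mat_diag n (\<lambda>k. f k ^ l * f k)"
    by (rule mat_diag_diag)
  finally show ?case
    by (simp only: power_Suc2)
qed (simp add: mat_diag_def)

lemma cscalar_prod_mult_mat_vec: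
  fixes S :: "complex mat"
  assumes "S \<in> carrier_mat n m" "x \<in> carrier_vec n" "v \<in> carrier_vec m"
  shows "x \<bullet>c (S *\<^sub>v v) = (mat_adjoint S *\<^sub>v x) \<bullet>c v"
proof -
  have "x \<bullet>c (S *\<^sub>v v) = (\<Sum>i<n. \<Sum>k<m. x $ i * cnj (S $$ (i, k) * v $ k))"
    using assms by (simp add: scalar_prod_def atLeast0LessThan sum_distrib_left)
  also have "\<dots> = (\<Sum>k<m. \<Sum>i<n. x $ i * cnj (S $$ (i, k) * v $ k))"
    by (rule sum.swap)
  also have "\<dots> = (mat_adjoint S *\<^sub>v x) \<bullet>c v"
    using assms
    by (simp add: scalar_prod_def atLeast0LessThan sum_distrib_left mat_adjoint_def ac_simps)
  finally show ?thesis .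
qed

lemma sample_eq_exp_sum:
  assumes S: "S \<in> carrier_mat d d" "invertible_mat S"
    and x: "x \<in> carrier_vec d" and \<phi>: "\<phi> \<in> carrier_vec d"
  shows "cmod (x \<bullet>c (((S * mat_diag d \<mu> * inv_mat S) ^\<^sub>m l) *\<^sub>v \<phi>)) =
    cmod (\<Sum>k\<in>supp_vec (inv_mat S *\<^sub>v \<phi>).
      ((inv_mat S *\<^sub>v \<phi>) $ k * cnj ((mat_adjoint S *\<^sub>v x) $ k)) * \<mu> k ^ l)"
proof -
  note inv = inv_mat[OF S]
  define \<psi> where "\<psi> = inv_mat S *\<^sub>v \<phi>"
  define y where "y = mat_adjoint S *\<^sub>v x"
  let ?D = "mat_diag d (\<lambda>k. \<mu> k ^ l)"
  have \<psi>: "\<psi> \<in> carrier_vec d"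
    using inv \<phi> by (simp add: \<psi>_def)
  have D\<psi>: "?D *\<^sub>v \<psi> = vec d (\<lambda>k. \<mu> k ^ l * \<psi> $ k)"
    using \<psi> by (intro eq_vecI)
      (auto simp: mat_diag_def scalar_prod_def if_distrib[of "\<lambda>z. z * _"] cong: if_cong)
  have "similar_mat_wit (S * mat_diag d \<mu> * inv_mat S) (mat_diag d \<mu>) S (inv_mat S)"
    using inv S by (intro similar_mat_witI[where n = d]) auto
  then have "(S * mat_diag d \<mu> * inv_mat S) ^\<^sub>m l = S * ?D * inv_mat S"
    by (simp add: similar_mat_wit_pow_id mat_diag_pow)
  also have "\<dots> *\<^sub>v \<phi> = S *\<^sub>v (?D *\<^sub>v \<psi>)"
    using inv S \<phi> by (simp add: \<psi>_def assoc_mult_mat_vec[of _ d d _ d] mult_carrier_mat[of _ d d _ d])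
  finally have "x \<bullet>c (((S * mat_diag d \<mu> * inv_mat S) ^\<^sub>m l) *\<^sub>v \<phi>) = y \<bullet>c (?D *\<^sub>v \<psi>)"
    using S(1) x by (simp add: cscalar_prod_mult_mat_vec[of _ d d] y_def D\<psi>)
  also have "\<dots> = (\<Sum>k<d. y $ k * cnj (\<mu> k ^ l * \<psi> $ k))"
    by (simp add: D\<psi> scalar_prod_def atLeast0LessThan)
  \<comment> \<open>Since \<open>\<bullet>c\<close> conjugates its second argument, the eigenvalues
    appear conjugated; conjugating the whole sum undoes this and leaves \<open>cmod\<close>
    unchanged.\<close>
  also have "\<dots> = cnj (\<Sum>k<d. (\<psi> $ k * cnj (y $ k)) * \<mu> k ^ l)"
    by (simp add: ac_simps)
  also have "(\<Sum>k<d. (\<psi> $ k * cnj (y $ k)) * \<mu> k ^ l) =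
      (\<Sum>k\<in>supp_vec \<psi>. (\<psi> $ k * cnj (y $ k)) * \<mu> k ^ l)"
    using \<psi> by (intro sum.mono_neutral_right) (auto simp: supp_vec_def)
  finally show ?thesis
    unfolding \<psi>_def[symmetric] y_def[symmetric] by (simp only: complex_mod_cnj)
qed

lemma mat_adjoint_mult_vec_cancel:
  fixes S :: "complex mat"
  assumes S: "S \<in> carrier_mat d d" "invertible_mat S"
    and x: "x \<in> carrier_vec d" and x': "x' \<in> carrier_vec d"
    and eq: "\<And>k. k < d \<Longrightarrow> (mat_adjoint S *\<^sub>v x') $ k = \<tau> * (mat_adjoint S *\<^sub>v x) $ k"
  shows "x' = \<tau> \<cdot>\<^sub>v x"
proof (rule eq_vecI)
  fix k
  assume "k < dim_vec (\<tau> \<cdot>\<^sub>v x)"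
  then have k: "k < d"
    using x by simp
  note inv = inv_mat[OF S]
  \<comment> \<open>The \<open>k\<close>-th column of the inverse: pairing the adjoint image of any
    \<open>z\<close> with it reads off \<open>z $ k\<close>, so the adjoint of \<open>S\<close> is
    injective.\<close>
  define v where "v = inv_mat S *\<^sub>v unit_vec d k"
  have v: "v \<in> carrier_vec d"
    using inv by (simp add: v_def)
  have Sv: "S *\<^sub>v v = unit_vec d k"
    using inv S by (simp add: v_def assoc_mult_mat_vec[of _ d d _ d, symmetric])
  have entry: "z $ k = (mat_adjoint S *\<^sub>v z) \<bullet>c v" if "z \<in> carrier_vec d" for z
  proof -
    have "z \<bullet>c (S *\<^sub>v v) = (\<Sum>i<d. z $ i * cnj (if i = k then 1 else 0))"
      unfolding Sv using that k by (auto simp: scalar_prod_def atLeast0LessThan intro!: sum.cong)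
    also have "\<dots> = z $ k"
      using k by (simp add: if_distrib[of cnj] if_distrib[of "\<lambda>w. _ * w"] cong: if_cong)
    finally show ?thesis
      using cscalar_prod_mult_mat_vec[OF S(1) that v] by simp
  qed
  show "x' $ k = (\<tau> \<cdot>\<^sub>v x) $ k"
    using x k v eq
    by (simp add: entry[OF x'] entry[OF x] scalar_prod_def atLeast0LessThan sum_distrib_left ac_simps)
qed (use x x' in simp)

theorem theorem7p1:
  fixes d J :: nat
    and S A A' :: "complex mat"
    and lam lam' :: "nat \<Rightarrow> complex"
    and \<phi> :: "nat \<Rightarrow> complex vec"
    and x x' :: "complex vec"
  assumes "d \<ge> 2"
    and "S \<in> carrier_mat d d" and "invertible_mat S"
    and "\<And>i. i < J \<Longrightarrow> \<phi> i \<in> carrier_vec d"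
    and "allows_identification_and_retrieval d J S \<phi>"
    and "A = S * mat_diag d lam * inv_mat S"
    and "absolutely_collision_free d lam"
    and "x \<in> carrier_vec d"
    and "\<And>k. k < d \<Longrightarrow> (mat_adjoint S *\<^sub>v x) $ k \<noteq> 0"
    and "A' = S * mat_diag d lam' * inv_mat S"
    and "absolutely_collision_free d lam'"
    and "x' \<in> carrier_vec d"
    and "\<And>k. k < d \<Longrightarrow> (mat_adjoint S *\<^sub>v x') $ k \<noteq> 0"
    and "\<And>i l. i < J \<Longrightarrow> l < 2 * (card (supp_vec (inv_mat S *\<^sub>v \<phi> i)))\<^sup>2 \<Longrightarrow>
           cmod (x' \<bullet>c ((A' ^\<^sub>m l) *\<^sub>v \<phi> i)) = cmod (x \<bullet>c ((A ^\<^sub>m l) *\<^sub>v \<phi> i))"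
  shows "\<exists>\<theta> \<eta> :: real.
           (\<forall>k<d. lam' k = exp (\<i> * complex_of_real \<theta>) * lam k) \<and>
           x' = exp (\<i> * complex_of_real \<eta>) \<cdot>\<^sub>v x"
proof -
  let ?\<psi> = "\<lambda>i. inv_mat S *\<^sub>v \<phi> i"
  let ?y = "\<lambda>k. (mat_adjoint S *\<^sub>v x) $ k" and ?y' = "\<lambda>k. (mat_adjoint S *\<^sub>v x') $ k"
  have cond: "index_separation d J ?\<psi>" "phase_propagation J ?\<psi>"
    "winding_direction_determination d J ?\<psi>"
    using assms(5) by (simp_all add: allows_identification_and_retrieval_def Let_def)
  obtain \<rho> \<tau> where \<rho>\<tau>: "cmod \<rho> = 1" "cmod \<tau> = 1"
    "\<And>k. k < d \<Longrightarrow> lam' k = \<rho> * lam k" "\<And>k. k < d \<Longrightarrow> ?y' k = \<tau> * ?y k"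
  proof (rule spectrum_and_coordinates_determined[OF assms(1) cond])
    show "dim_vec (?\<psi> i) = d" for i
      using inv_mat(1)[OF assms(2,3)] by simp
    show "cmod (\<Sum>k\<in>supp_vec (?\<psi> i). (?\<psi> i $ k * cnj (?y' k)) * lam' k ^ l) =
        cmod (\<Sum>k\<in>supp_vec (?\<psi> i). (?\<psi> i $ k * cnj (?y k)) * lam k ^ l)"
      if "i < J" "l < 2 * (card (supp_vec (?\<psi> i)))\<^sup>2" for i l
      using assms(14)[OF that] assms(4)[OF that(1)]
      by (simp add: assms(6,10) sample_eq_exp_sum[OF assms(2,3)] assms(8,12))
  qed (use assms(7,9,11,13) in auto)
  have "\<rho> = exp (\<i> * complex_of_real (Arg \<rho>))" "\<tau> = exp (\<i> * complex_of_real (Arg \<tau>))"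
    using rcis_cmod_Arg[of \<rho>] rcis_cmod_Arg[of \<tau>] \<rho>\<tau>(1,2)
    by (simp_all add: rcis_def cis_conv_exp)
  moreover have "x' = \<tau> \<cdot>\<^sub>v x"
    using mat_adjoint_mult_vec_cancel[OF assms(2,3,8,12)] \<rho>\<tau>(4) by blast
  ultimately show ?thesis
    using \<rho>\<tau>(3) by metis
qed

end
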